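(* The set $B_\bullet$ equipped with the binary operations $$x\lceil y\rceil = x\cdot\partial y\cdot\sigma_1\cdot\partial x^{-1},\qquad x\circ y=x\cdot\partial y\cdot a_1$$ is an augmented LD-system, i.e., for all $x,y,z\in B_\bullet$, $$x\lceil y\lceil z\rceil\rceil=(x\lceil y\rceil)\lceil x\lceil z\rceil\rceil,\qquad x\lceil y\lceil z\rceil\rceil=(x\circ y)\lceil z\rceil,\qquad x\lceil y\circ z\rceil=(x\lceil y\rceil)\circ(x\lceil z\rceil).$$ Furthermore the bracket is left cancellative: for all $x,y,z\in B_\bullet$, $x\lceil y\rceil=x\lceil z\rceil$ implies $y=z$.
   Context: $B_\bullet$ is the group (of parenthesized braids) presented by generators $\sigma_i,a_i$ ($i\ge1$) and the relations, for all $i\ge1$ and $j\ge i+2$: $\sigma_i\sigma_j=\sigma_j\sigma_i$, $\sigma_ia_j=a_j\sigma_i$, $a_ia_{j-1}=a_ja_i$, $a_i\sigma_{j-1}=\sigma_ja_i$, $\sigma_i\sigma_{i+1}\sigma_i=\sigma_{i+1}\sigma_i\sigma_{i+1}$, $\sigma_{i+1}\sigma_ia_{i+1}=a_i\sigma_i$, $\sigma_i\sigma_{i+1}a_i=a_{i+1}\sigma_i$. The map $\partial$ is the (injective) endomorphism of this group that maps $\sigma_i$ to $\sigma_{i+1}$ and $a_i$ to $a_{i+1}$ for each $i$. The expression $\partial x^{-1}$ means $(\partial x)^{-1}=\partial(x^{-1})$. *)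

theory Defs
  imports "HOL-Algebra.Group"
begin

section \<open>Groups given by generators and relations\<close>

text \<open>A signed letter \<open>(True, g)\<close> stands for \<open>g\<close>, and \<open>(False, g)\<close> for its formal inverse.\<close>

type_synonym 'g word = "(bool \<times> 'g) list"

definition words_over :: "'g set \<Rightarrow> 'g word set" where
  "words_over X = lists (UNIV \<times> X)"

text \<open>The least congruence on words over \<open>X\<close> that contains the defining relations \<open>R\<close> and
  makes \<open>(True, g)\<close> and \<open>(False, g)\<close> inverse to each other.\<close>

inductive pres_eq :: "'g set \<Rightarrow> ('g word \<times> 'g word) set \<Rightarrow> 'g word \<Rightarrow> 'g word \<Rightarrow> bool"
  for X :: "'g set" and R :: "('g word \<times> 'g word) set" where
  refl: "u \<in> words_over X \<Longrightarrow> pres_eq X R u u"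
| sym: "pres_eq X R u v \<Longrightarrow> pres_eq X R v u"
| trans: "pres_eq X R u v \<Longrightarrow> pres_eq X R v w \<Longrightarrow> pres_eq X R u w"
| append: "pres_eq X R u u' \<Longrightarrow> pres_eq X R v v' \<Longrightarrow> pres_eq X R (u @ v) (u' @ v')"
| cancel: "g \<in> X \<Longrightarrow> pres_eq X R [(b, g), (\<not> b, g)] []"
| rel: "(u, v) \<in> R \<Longrightarrow> u \<in> words_over X \<Longrightarrow> v \<in> words_over X \<Longrightarrow> pres_eq X R u v"

definition pres_class :: "'g set \<Rightarrow> ('g word \<times> 'g word) set \<Rightarrow> 'g word \<Rightarrow> 'g word set" where
  "pres_class X R u = {v. pres_eq X R u v}"

definition pres_group :: "'g set \<Rightarrow> ('g word \<times> 'g word) set \<Rightarrow> 'g word set monoid" where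
  "pres_group X R =
    \<lparr> carrier = pres_class X R ` words_over X,
      mult = (\<lambda>U V. \<Union>u\<in>U. \<Union>v\<in>V. pres_class X R (u @ v)),
      one = pres_class X R [] \<rparr>"

lemma pres_eq_words:
  "pres_eq X R u v \<Longrightarrow> u \<in> words_over X \<and> v \<in> words_over X"
  by (induction rule: pres_eq.induct) (auto simp: words_over_def)

lemma pres_class_eqI:
  assumes "pres_eq X R u v"
  shows "pres_class X R u = pres_class X R v"
  using pres_eq.trans[OF assms] pres_eq.trans[OF pres_eq.sym[OF assms]]
  by (auto simp: pres_class_def)

lemma pres_class_self: "u \<in> words_over X \<Longrightarrow> u \<in> pres_class X R u"
  by (simp add: pres_class_def pres_eq.refl)

lemma pres_class_eq_iff:
  "u \<in> words_over X \<Longrightarrow> v \<in> words_over X \<Longrightarrow>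
    pres_class X R u = pres_class X R v \<longleftrightarrow> pres_eq X R u v"
  using pres_class_eqI[of X R u v] pres_class_self[of v X R] by (auto simp: pres_class_def)

lemma pres_group_mult:
  assumes "u \<in> words_over X" "v \<in> words_over X"
  shows "pres_class X R u \<otimes>\<^bsub>pres_group X R\<^esub> pres_class X R v = pres_class X R (u @ v)"
proof -
  have "pres_class X R (u' @ v') = pres_class X R (u @ v)"
    if "u' \<in> pres_class X R u" "v' \<in> pres_class X R v" for u' v'
  proof -
    have "pres_eq X R u u'" "pres_eq X R v v'"
      using that by (simp_all add: pres_class_def)
    from pres_class_eqI[OF pres_eq.append[OF this]] show ?thesis by (rule HOL.sym)
  qed
  then have "(\<Union>u'\<in>pres_class X R u. \<Union>v'\<in>pres_class X R v. pres_class X R (u' @ v'))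
      = (\<Union>u'\<in>pres_class X R u. \<Union>v'\<in>pres_class X R v. pres_class X R (u @ v))"
    by (intro SUP_cong HOL.refl)
  also have "\<dots> = pres_class X R (u @ v)"
    using pres_class_self[OF assms(1), of R] pres_class_self[OF assms(2), of R] by auto
  finally show ?thesis by (simp add: pres_group_def)
qed

lemma inverse_word_words:
  "u \<in> words_over X \<Longrightarrow> map (map_prod Not id) (rev u) \<in> words_over X"
  by (induction u) (auto simp: words_over_def)

lemma pres_eq_inverse:
  "u \<in> words_over X \<Longrightarrow> pres_eq X R (map (map_prod Not id) (rev u) @ u) []"
proof (induction u)
  case Nil
  then show ?case by (simp add: pres_eq.refl)
next
  case (Cons a u)
  obtain b g where a: "a = (b, g)" by (cases a)
  have g: "g \<in> X" and u: "u \<in> words_over X"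
    using Cons.prems by (auto simp: a words_over_def)
  let ?i = "map (map_prod Not id) (rev u)"
  have i: "?i \<in> words_over X"
    using u by (rule inverse_word_words)
  have "pres_eq X R ([(\<not> b, g), (\<not> \<not> b, g)] @ u) ([] @ u)"
    by (intro pres_eq.append pres_eq.cancel pres_eq.refl g u)
  then have "pres_eq X R ([(\<not> b, g), (b, g)] @ u) u"
    by simp
  from pres_eq.trans[OF pres_eq.append[OF pres_eq.refl[OF i] this] Cons.IH[OF u]]
  show ?case by (simp add: a id_def)
qed

lemma pres_group_is_group: "group (pres_group X R)"
proof (rule groupI)
  have carr: "carrier (pres_group X R) = pres_class X R ` words_over X"
    and one: "\<one>\<^bsub>pres_group X R\<^esub> = pres_class X R []"
    by (simp_all add: pres_group_def)
  have nil: "[] \<in> words_over X"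
    and app: "\<And>u v. u \<in> words_over X \<Longrightarrow> v \<in> words_over X \<Longrightarrow> u @ v \<in> words_over X"
    by (auto simp: words_over_def)
  show "\<one>\<^bsub>pres_group X R\<^esub> \<in> carrier (pres_group X R)"
    using nil by (simp add: carr one)
  fix x assume "x \<in> carrier (pres_group X R)"
  then obtain u where u: "u \<in> words_over X" and x: "x = pres_class X R u"
    by (auto simp: carr)
  show "\<one>\<^bsub>pres_group X R\<^esub> \<otimes>\<^bsub>pres_group X R\<^esub> x = x"
    by (simp add: one x pres_group_mult[OF nil u])
  let ?i = "map (map_prod Not id) (rev u)"
  have i: "?i \<in> words_over X"
    using u by (rule inverse_word_words)
  have "pres_class X R ?i \<otimes>\<^bsub>pres_group X R\<^esub> x = \<one>\<^bsub>pres_group X R\<^esub>"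
    by (simp only: x one pres_group_mult[OF i u] pres_class_eqI[OF pres_eq_inverse[OF u]])
  then show "\<exists>y\<in>carrier (pres_group X R). y \<otimes>\<^bsub>pres_group X R\<^esub> x = \<one>\<^bsub>pres_group X R\<^esub>"
    using i by (auto simp: carr)
  fix y assume "y \<in> carrier (pres_group X R)"
  then obtain v where v: "v \<in> words_over X" and y: "y = pres_class X R v"
    by (auto simp: carr)
  show "x \<otimes>\<^bsub>pres_group X R\<^esub> y \<in> carrier (pres_group X R)"
    using app[OF u v] by (simp add: x y carr pres_group_mult[OF u v])
  fix z assume "z \<in> carrier (pres_group X R)"
  then obtain w where w: "w \<in> words_over X" and z: "z = pres_class X R w"
    by (auto simp: carr)
  show "x \<otimes>\<^bsub>pres_group X R\<^esub> y \<otimes>\<^bsub>pres_group X R\<^esub> z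
      = x \<otimes>\<^bsub>pres_group X R\<^esub> (y \<otimes>\<^bsub>pres_group X R\<^esub> z)"
    by (simp add: x y z u v w app pres_group_mult)
qed


section \<open>The group of parenthesized braids\<close>

datatype pb_gen = Sigma nat | A nat

definition pb_gens :: "pb_gen set" where
  "pb_gens = Sigma ` {1..} \<union> A ` {1..}"

abbreviation ws :: "nat \<Rightarrow> pb_gen word" where "ws i \<equiv> [(True, Sigma i)]"
abbreviation wa :: "nat \<Rightarrow> pb_gen word" where "wa i \<equiv> [(True, A i)]"

inductive_set pb_rels :: "(pb_gen word \<times> pb_gen word) set" where
  "i \<ge> 1 \<Longrightarrow> j \<ge> i + 2 \<Longrightarrow> (ws i @ ws j, ws j @ ws i) \<in> pb_rels"
| "i \<ge> 1 \<Longrightarrow> j \<ge> i + 2 \<Longrightarrow> (ws i @ wa j, wa j @ ws i) \<in> pb_rels"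
| "i \<ge> 1 \<Longrightarrow> j \<ge> i + 2 \<Longrightarrow> (wa i @ wa (j - 1), wa j @ wa i) \<in> pb_rels"
| "i \<ge> 1 \<Longrightarrow> j \<ge> i + 2 \<Longrightarrow> (wa i @ ws (j - 1), ws j @ wa i) \<in> pb_rels"
| "i \<ge> 1 \<Longrightarrow> (ws i @ ws (i + 1) @ ws i, ws (i + 1) @ ws i @ ws (i + 1)) \<in> pb_rels"
| "i \<ge> 1 \<Longrightarrow> (ws (i + 1) @ ws i @ wa (i + 1), wa i @ ws i) \<in> pb_rels"
| "i \<ge> 1 \<Longrightarrow> (ws i @ ws (i + 1) @ wa i, wa (i + 1) @ ws i) \<in> pb_rels"

type_synonym pb = "pb_gen word set"

definition PB :: "pb monoid" where
  "PB = pres_group pb_gens pb_rels"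

abbreviation pb_class :: "pb_gen word \<Rightarrow> pb" where
  "pb_class \<equiv> pres_class pb_gens pb_rels"

definition pb_sigma :: "nat \<Rightarrow> pb" where
  "pb_sigma i = pb_class (ws i)"

definition pb_a :: "nat \<Rightarrow> pb" where
  "pb_a i = pb_class (wa i)"

fun shift_gen :: "pb_gen \<Rightarrow> pb_gen" where
  "shift_gen (Sigma i) = Sigma (i + 1)"
| "shift_gen (A i) = A (i + 1)"

definition shift_word :: "pb_gen word \<Rightarrow> pb_gen word" where
  "shift_word = map (map_prod id shift_gen)"

text \<open>The endomorphism \<open>\<partial>\<close>, given on the class of a word by shifting all indices; see
  \<open>pb_shift_class\<close>, \<open>pb_shift_hom\<close>, \<open>pb_shift_sigma\<close> and \<open>pb_shift_a\<close> below.\<close>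

definition pb_shift :: "pb \<Rightarrow> pb" where
  "pb_shift U = (\<Union>u\<in>U. pb_class (shift_word u))"

lemma PB_group: "group PB"
  unfolding PB_def by (rule pres_group_is_group)

lemma pb_sigma_in_carrier: "i \<ge> 1 \<Longrightarrow> pb_sigma i \<in> carrier PB"
  by (auto simp: PB_def pres_group_def pb_sigma_def words_over_def pb_gens_def)

lemma pb_a_in_carrier: "i \<ge> 1 \<Longrightarrow> pb_a i \<in> carrier PB"
  by (auto simp: PB_def pres_group_def pb_a_def words_over_def pb_gens_def)

lemma shift_gen_gens: "g \<in> pb_gens \<Longrightarrow> shift_gen g \<in> pb_gens"
  by (auto simp: pb_gens_def)

lemma shift_word_words:
  "u \<in> words_over pb_gens \<Longrightarrow> shift_word u \<in> words_over pb_gens"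
  by (induction u) (auto simp: shift_word_def words_over_def shift_gen_gens)

lemma shift_word_append: "shift_word (u @ v) = shift_word u @ shift_word v"
  by (simp add: shift_word_def)

lemma shift_word_rels: "(u, v) \<in> pb_rels \<Longrightarrow> (shift_word u, shift_word v) \<in> pb_rels"
proof (induction rule: pb_rels.induct)
  case (1 i j) then show ?case
    using pb_rels.intros(1)[of "i + 1" "j + 1"] by (simp add: shift_word_def)
next
  case (2 i j) then show ?case
    using pb_rels.intros(2)[of "i + 1" "j + 1"] by (simp add: shift_word_def)
next
  case (3 i j) then show ?case
    using pb_rels.intros(3)[of "i + 1" "j + 1"] by (simp add: shift_word_def)
next
  case (4 i j) then show ?case
    using pb_rels.intros(4)[of "i + 1" "j + 1"] by (simp add: shift_word_def)
next
  case (5 i) then show ?case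
    using pb_rels.intros(5)[of "i + 1"] by (simp add: shift_word_def)
next
  case (6 i) then show ?case
    using pb_rels.intros(6)[of "i + 1"] by (simp add: shift_word_def)
next
  case (7 i) then show ?case
    using pb_rels.intros(7)[of "i + 1"] by (simp add: shift_word_def)
qed

lemma shift_word_eq:
  "pres_eq pb_gens pb_rels u v \<Longrightarrow> pres_eq pb_gens pb_rels (shift_word u) (shift_word v)"
proof (induction rule: pres_eq.induct)
  case (cancel g b)
  then show ?case
    using pres_eq.cancel[OF shift_gen_gens] by (simp add: shift_word_def)
next
  case (append u u' v v')
  then show ?case by (simp add: shift_word_append pres_eq.append)
next
  case (rel u v)
  then show ?case by (intro pres_eq.rel shift_word_rels shift_word_words)
next
  case (refl u)
  then show ?case by (intro pres_eq.refl shift_word_words)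
next
  case (sym u v)
  from sym.IH show ?case by (rule pres_eq.sym)
next
  case (trans u v w)
  from trans.IH show ?case by (rule pres_eq.trans)
qed

lemma pb_shift_class:
  assumes "u \<in> words_over pb_gens"
  shows "pb_shift (pb_class u) = pb_class (shift_word u)"
proof -
  have "pb_class (shift_word v) = pb_class (shift_word u)" if "v \<in> pb_class u" for v
  proof -
    have "pres_eq pb_gens pb_rels u v"
      using that by (simp add: pres_class_def)
    from pres_class_eqI[OF shift_word_eq[OF this]] show ?thesis by (rule HOL.sym)
  qed
  then have "pb_shift (pb_class u) = (\<Union>v\<in>pb_class u. pb_class (shift_word u))"
    unfolding pb_shift_def by (intro SUP_cong HOL.refl)
  also have "\<dots> = pb_class (shift_word u)"
    using pres_class_self[OF assms, of pb_rels] by auto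
  finally show ?thesis .
qed

lemma pb_shift_hom: "pb_shift \<in> hom PB PB"
proof (rule homI)
  fix x assume "x \<in> carrier PB"
  then obtain u where u: "u \<in> words_over pb_gens" and x: "x = pb_class u"
    by (auto simp: PB_def pres_group_def)
  show "pb_shift x \<in> carrier PB"
    using shift_word_words[OF u] by (simp add: x pb_shift_class[OF u] PB_def pres_group_def)
  fix y assume "y \<in> carrier PB"
  then obtain v where v: "v \<in> words_over pb_gens" and y: "y = pb_class v"
    by (auto simp: PB_def pres_group_def)
  have uv: "u @ v \<in> words_over pb_gens"
    using u v by (auto simp: words_over_def)
  show "pb_shift (x \<otimes>\<^bsub>PB\<^esub> y) = pb_shift x \<otimes>\<^bsub>PB\<^esub> pb_shift y"
    by (simp add: x y PB_def pres_group_mult u v uv shift_word_words pb_shift_class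
        shift_word_append)
qed

lemma pb_shift_sigma: "i \<ge> 1 \<Longrightarrow> pb_shift (pb_sigma i) = pb_sigma (i + 1)"
  unfolding pb_sigma_def
  by (subst pb_shift_class) (auto simp: words_over_def pb_gens_def shift_word_def)

lemma pb_shift_a: "i \<ge> 1 \<Longrightarrow> pb_shift (pb_a i) = pb_a (i + 1)"
  unfolding pb_a_def
  by (subst pb_shift_class) (auto simp: words_over_def pb_gens_def shift_word_def)

definition pb_bracket :: "pb \<Rightarrow> pb \<Rightarrow> pb" where
  "pb_bracket x y =
    x \<otimes>\<^bsub>PB\<^esub> pb_shift y \<otimes>\<^bsub>PB\<^esub> pb_sigma 1 \<otimes>\<^bsub>PB\<^esub> inv\<^bsub>PB\<^esub> (pb_shift x)"

definition pb_circ :: "pb \<Rightarrow> pb \<Rightarrow> pb" where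
  "pb_circ x y = x \<otimes>\<^bsub>PB\<^esub> pb_shift y \<otimes>\<^bsub>PB\<^esub> pb_a 1"


section \<open>Augmented LD-systems\<close>

definition augmented_LD_system :: "'a set \<Rightarrow> ('a \<Rightarrow> 'a \<Rightarrow> 'a) \<Rightarrow> ('a \<Rightarrow> 'a \<Rightarrow> 'a) \<Rightarrow> bool" where
  "augmented_LD_system S br circ \<longleftrightarrow>
    (\<forall>x\<in>S. \<forall>y\<in>S. br x y \<in> S \<and> circ x y \<in> S) \<and>
    (\<forall>x\<in>S. \<forall>y\<in>S. \<forall>z\<in>S.
      br x (br y z) = br (br x y) (br x z) \<and>
      br x (br y z) = br (circ x y) z \<and>
      br x (circ y z) = circ (br x y) (br x z))"

end

theory Submission
  imports Defs
begin

text \<open>The identities follow from the defining relations once one knows that \<open>\<sigma>\<^sub>1\<close> commutes with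
  \<open>\<partial>\<^sup>2x\<close> and that \<open>a\<^sub>1 \<cdot> \<partial>x = \<partial>\<^sup>2x \<cdot> a\<^sub>1\<close> for all \<open>x\<close>.

  Left cancellativity amounts to injectivity of \<open>\<partial>\<close>, and this holds because \<open>\<partial>\<close> is locally almost
  inner: for \<open>\<delta>\<^sub>n = \<sigma>\<^sub>1 \<cdots> \<sigma>\<^sub>n\<close> and \<open>n\<close> large with respect to \<open>i\<close> one has
  \<open>\<sigma>\<^sub>i\<^sub>+\<^sub>1 \<cdot> \<delta>\<^sub>n = \<delta>\<^sub>n \<cdot> \<sigma>\<^sub>i\<close> and \<open>a\<^sub>i\<^sub>+\<^sub>1 \<cdot> \<delta>\<^sub>n = \<delta>\<^sub>n\<^sub>+\<^sub>1 \<cdot> a\<^sub>i\<close>.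
  Hence \<open>\<partial>x \<cdot> \<delta>\<^sub>n = \<delta>\<^sub>n\<^sub>+\<^sub>e \<cdot> x\<close> for large \<open>n\<close>, where \<open>e\<close> is the exponent sum of the
  letters \<open>a\<^sub>i\<close> in \<open>x\<close>. As \<open>e\<close> is an invariant of the group that \<open>\<partial>\<close> preserves, \<open>\<partial>x\<close> determines
  \<open>x\<close>.\<close>

section \<open>The identities in a group with an endomorphism\<close>

text \<open>Rewriting moves \<open>s\<close> to the right past the elements \<open>d (d w)\<close>
  and their inverses; after cancellation, each law comes down to one of \<open>braid\<close>,
  \<open>ssa\<close> and \<open>sas\<close>. The auxiliary facts with a trailing factor
  \<open>v\<close> serve products bracketed to the right.\<close>

lemma (in group) shifted_bracket_laws:
  assumes d: "d \<in> hom G G" and s: "s \<in> carrier G" and a: "a \<in> carrier G"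
    and s_comm: "\<And>x. x \<in> carrier G \<Longrightarrow> s \<otimes> d (d x) = d (d x) \<otimes> s"
    and a_comm: "\<And>x. x \<in> carrier G \<Longrightarrow> a \<otimes> d x = d (d x) \<otimes> a"
    and braid: "s \<otimes> d s \<otimes> s = d s \<otimes> s \<otimes> d s"
    and ssa: "d s \<otimes> s \<otimes> d a = a \<otimes> s"
    and sas: "s \<otimes> d s \<otimes> a = d a \<otimes> s"
  defines "br \<equiv> \<lambda>x y. x \<otimes> d y \<otimes> s \<otimes> inv (d x)" and "ci \<equiv> \<lambda>x y. x \<otimes> d y \<otimes> a"
  assumes x: "x \<in> carrier G" and y: "y \<in> carrier G" and z: "z \<in> carrier G"
  shows "br x (br y z) = br (br x y) (br x z)"
    and "br x (br y z) = br (ci x y) z"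
    and "br x (ci y z) = ci (br x y) (br x z)"
proof -
  interpret d: group_hom G G d
    using d by (simp add: group_hom_def group_hom_axioms_def group_axioms)
  have comm_inv: "s \<otimes> inv (d (d w)) = inv (d (d w)) \<otimes> s" if "w \<in> carrier G" for w
    using s_comm[of "inv w"] that by simp
  have s_left: "s \<otimes> (d (d w) \<otimes> v) = d (d w) \<otimes> (s \<otimes> v)"
    if "w \<in> carrier G" "v \<in> carrier G" for w v
    using s_comm[of w] s that by (simp flip: m_assoc)
  have s_inv_left: "s \<otimes> (inv (d (d w)) \<otimes> v) = inv (d (d w)) \<otimes> (s \<otimes> v)"
    if "w \<in> carrier G" "v \<in> carrier G" for w v
    using comm_inv[of w] s that by (simp flip: m_assoc)
  have a_left: "a \<otimes> (d w \<otimes> v) = d (d w) \<otimes> (a \<otimes> v)"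
    if "w \<in> carrier G" "v \<in> carrier G" for w v
    using a_comm[of w] a that by (simp flip: m_assoc)
  have a_inv: "inv (d (d w)) \<otimes> a = a \<otimes> inv (d w)" if "w \<in> carrier G" for w
    using a_comm[of "inv w"] that by simp
  have cancel: "u \<otimes> (inv u \<otimes> v) = v" "inv u \<otimes> (u \<otimes> v) = v"
    if "u \<in> carrier G" "v \<in> carrier G" for u v
    using that by (simp_all flip: m_assoc)
  \<comment> \<open>The factor \<open>inv (d s)\<close> stems from the inverse of
    \<open>d (br x y)\<close> that ends the outer bracket; in \<open>ssa'\<close> below,
    \<open>inv (d a)\<close> stems likewise from \<open>d (ci x y)\<close>.\<close>
  have braid': "s \<otimes> (d s \<otimes> (s \<otimes> (inv (d s) \<otimes> v))) = d s \<otimes> (s \<otimes> v)"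
    if "v \<in> carrier G" for v
  proof -
    have "s \<otimes> (d s \<otimes> (s \<otimes> (inv (d s) \<otimes> v))) = (s \<otimes> d s \<otimes> s) \<otimes> (inv (d s) \<otimes> v)"
      using s that by (simp add: m_assoc)
    also have "\<dots> = d s \<otimes> (s \<otimes> v)"
      unfolding braid using s that by (simp add: m_assoc cancel)
    finally show ?thesis .
  qed
  have ssa': "a \<otimes> (s \<otimes> (inv (d a) \<otimes> v)) = d s \<otimes> (s \<otimes> v)" if "v \<in> carrier G" for v
  proof -
    have "a \<otimes> (s \<otimes> (inv (d a) \<otimes> v)) = (d s \<otimes> s \<otimes> d a) \<otimes> (inv (d a) \<otimes> v)"
      using s a that by (simp add: ssa flip: m_assoc)
    also have "\<dots> = d s \<otimes> (s \<otimes> v)"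
      using s a that by (simp add: m_assoc cancel)
    finally show ?thesis .
  qed
  have sas': "s \<otimes> (d s \<otimes> (a \<otimes> v)) = d a \<otimes> (s \<otimes> v)" if "v \<in> carrier G" for v
    using s a that sas by (simp flip: m_assoc)
  show "br x (br y z) = br (br x y) (br x z)"
    using x y z s
    by (simp add: br_def m_assoc inv_mult_group s_left s_inv_left comm_inv cancel braid')
  show "br x (br y z) = br (ci x y) z"
    using x y z s a
    by (simp add: br_def ci_def m_assoc inv_mult_group s_left s_inv_left a_left ssa')
  show "br x (ci y z) = ci (br x y) (br x z)"
    using x y z s a
    by (simp add: br_def ci_def m_assoc s_left a_inv sas' cancel)
qed

section \<open>Words and relations in the group of parenthesized braids\<close>

interpretation PB: group PB
  by (rule PB_group)

interpretation pb_shift: group_hom PB PB pb_shift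
  by unfold_locales (rule pb_shift_hom)

lemma words_over_simps:
  "[] \<in> words_over X"
  "(b, g) # u \<in> words_over X \<longleftrightarrow> g \<in> X \<and> u \<in> words_over X"
  by (auto simp: words_over_def)

lemma pb_class_carrier: "u \<in> words_over pb_gens \<Longrightarrow> pb_class u \<in> carrier PB"
  by (simp add: PB_def pres_group_def)

lemma pb_carrierE:
  assumes "x \<in> carrier PB"
  obtains u where "u \<in> words_over pb_gens" "x = pb_class u"
  using assms by (auto simp: PB_def pres_group_def)

lemma pb_class_Nil: "pb_class [] = \<one>\<^bsub>PB\<^esub>"
  by (simp add: PB_def pres_group_def)

lemma pb_class_append:
  "u \<in> words_over pb_gens \<Longrightarrow> v \<in> words_over pb_gens \<Longrightarrow>
    pb_class (u @ v) = pb_class u \<otimes>\<^bsub>PB\<^esub> pb_class v"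
  by (simp add: PB_def pres_group_mult)

lemma pb_class_Cons:
  "g \<in> pb_gens \<Longrightarrow> u \<in> words_over pb_gens \<Longrightarrow>
    pb_class ((b, g) # u) = pb_class [(b, g)] \<otimes>\<^bsub>PB\<^esub> pb_class u"
  using pb_class_append[of "[(b, g)]" u] by (simp add: words_over_simps)

lemma pb_class_inv_letter:
  assumes "g \<in> pb_gens"
  shows "pb_class [(False, g)] = inv\<^bsub>PB\<^esub> pb_class [(True, g)]"
proof -
  have "pb_class [(False, g)] \<otimes>\<^bsub>PB\<^esub> pb_class [(True, g)] = \<one>\<^bsub>PB\<^esub>"
    using pres_class_eqI[OF pres_eq.cancel[OF assms, of pb_rels False]] assms
    by (simp add: pb_class_Cons[symmetric] words_over_simps pb_class_Nil)
  then show ?thesis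
    using PB.inv_equality assms by (simp add: pb_class_carrier words_over_simps)
qed

lemma pb_gensE:
  assumes "g \<in> pb_gens"
  obtains i where "i \<ge> 1" "g = Sigma i" | i where "i \<ge> 1" "g = A i"
  using assms by (auto simp: pb_gens_def)

lemma pb_rel_class:
  "(u, v) \<in> pb_rels \<Longrightarrow> u \<in> words_over pb_gens \<Longrightarrow> v \<in> words_over pb_gens \<Longrightarrow>
    pb_class u = pb_class v"
  by (intro pres_class_eqI pres_eq.rel)

text \<open>The relations of the presentation that contain \<open>j - 1\<close> are restated with
  \<open>j + 1\<close> in place of \<open>j\<close>, which removes the truncated
  subtraction.\<close>

lemma pb_relations:
  assumes i: "i \<ge> 1"
  shows pb_sigma_sigma: "j \<ge> i + 2 \<Longrightarrow>
      pb_sigma i \<otimes>\<^bsub>PB\<^esub> pb_sigma j = pb_sigma j \<otimes>\<^bsub>PB\<^esub> pb_sigma i"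
    and pb_sigma_a: "j \<ge> i + 2 \<Longrightarrow> pb_sigma i \<otimes>\<^bsub>PB\<^esub> pb_a j = pb_a j \<otimes>\<^bsub>PB\<^esub> pb_sigma i"
    and pb_a_a: "j \<ge> i + 1 \<Longrightarrow> pb_a i \<otimes>\<^bsub>PB\<^esub> pb_a j = pb_a (j + 1) \<otimes>\<^bsub>PB\<^esub> pb_a i"
    and pb_a_sigma: "j \<ge> i + 1 \<Longrightarrow>
      pb_a i \<otimes>\<^bsub>PB\<^esub> pb_sigma j = pb_sigma (j + 1) \<otimes>\<^bsub>PB\<^esub> pb_a i"
    and pb_braid: "pb_sigma i \<otimes>\<^bsub>PB\<^esub> (pb_sigma (i + 1) \<otimes>\<^bsub>PB\<^esub> pb_sigma i) =
      pb_sigma (i + 1) \<otimes>\<^bsub>PB\<^esub> (pb_sigma i \<otimes>\<^bsub>PB\<^esub> pb_sigma (i + 1))"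
    and pb_sigma_sigma_a_Suc: "pb_sigma (i + 1) \<otimes>\<^bsub>PB\<^esub> (pb_sigma i \<otimes>\<^bsub>PB\<^esub> pb_a (i + 1)) =
      pb_a i \<otimes>\<^bsub>PB\<^esub> pb_sigma i"
    and pb_sigma_sigma_a: "pb_sigma i \<otimes>\<^bsub>PB\<^esub> (pb_sigma (i + 1) \<otimes>\<^bsub>PB\<^esub> pb_a i) =
      pb_a (i + 1) \<otimes>\<^bsub>PB\<^esub> pb_sigma i"
proof -
  have gens: "Sigma k \<in> pb_gens" "A k \<in> pb_gens" if "k \<ge> 1" for k
    using that by (auto simp: pb_gens_def)
  note simps = pb_sigma_def pb_a_def pb_class_append[symmetric] words_over_simps gens
  show "pb_sigma i \<otimes>\<^bsub>PB\<^esub> pb_sigma j = pb_sigma j \<otimes>\<^bsub>PB\<^esub> pb_sigma i" if "j \<ge> i + 2"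
    using pb_rel_class[OF pb_rels.intros(1)[OF i that]] i that by (simp add: simps)
  show "pb_sigma i \<otimes>\<^bsub>PB\<^esub> pb_a j = pb_a j \<otimes>\<^bsub>PB\<^esub> pb_sigma i" if "j \<ge> i + 2"
    using pb_rel_class[OF pb_rels.intros(2)[OF i that]] i that by (simp add: simps)
  show "pb_a i \<otimes>\<^bsub>PB\<^esub> pb_a j = pb_a (j + 1) \<otimes>\<^bsub>PB\<^esub> pb_a i" if "j \<ge> i + 1"
    using pb_rel_class[OF pb_rels.intros(3)[OF i, of "j + 1"]] i that by (simp add: simps)
  show "pb_a i \<otimes>\<^bsub>PB\<^esub> pb_sigma j = pb_sigma (j + 1) \<otimes>\<^bsub>PB\<^esub> pb_a i" if "j \<ge> i + 1"
    using pb_rel_class[OF pb_rels.intros(4)[OF i, of "j + 1"]] i that by (simp add: simps)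
  show "pb_sigma i \<otimes>\<^bsub>PB\<^esub> (pb_sigma (i + 1) \<otimes>\<^bsub>PB\<^esub> pb_sigma i) =
      pb_sigma (i + 1) \<otimes>\<^bsub>PB\<^esub> (pb_sigma i \<otimes>\<^bsub>PB\<^esub> pb_sigma (i + 1))"
    using pb_rel_class[OF pb_rels.intros(5)[OF i]] i by (simp add: simps)
  show "pb_sigma (i + 1) \<otimes>\<^bsub>PB\<^esub> (pb_sigma i \<otimes>\<^bsub>PB\<^esub> pb_a (i + 1)) = pb_a i \<otimes>\<^bsub>PB\<^esub> pb_sigma i"
    using pb_rel_class[OF pb_rels.intros(6)[OF i]] i by (simp add: simps)
  show "pb_sigma i \<otimes>\<^bsub>PB\<^esub> (pb_sigma (i + 1) \<otimes>\<^bsub>PB\<^esub> pb_a i) = pb_a (i + 1) \<otimes>\<^bsub>PB\<^esub> pb_sigma i"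
    using pb_rel_class[OF pb_rels.intros(7)[OF i]] i by (simp add: simps)
qed

text \<open>Multiply the assumed relation by \<open>inv y\<close> on the left and by
  \<open>inv x\<close> on the right. The elements \<open>c\<close> and \<open>e\<close> may differ
  because passing a letter \<open>A i\<close> changes the index of \<open>pb_delta\<close>.\<close>

lemma (in group) intertwine_inv:
  assumes "x \<in> carrier G" "y \<in> carrier G" "c \<in> carrier G" "e \<in> carrier G"
    and "y \<otimes> c = e \<otimes> x"
  shows "inv y \<otimes> e = c \<otimes> inv x"
proof -
  have "inv y \<otimes> e = inv y \<otimes> (e \<otimes> x) \<otimes> inv x"
    using assms(1-4) by (simp add: m_assoc)
  also have "\<dots> = inv y \<otimes> (y \<otimes> c) \<otimes> inv x"
    by (simp add: assms(5))
  also have "\<dots> = c \<otimes> inv x"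
    using assms(1-4) by (simp flip: m_assoc)
  finally show ?thesis .
qed

text \<open>The relation is multiplicative in \<open>x\<close> and passes to inverses, so the
  generators decide. Two homomorphisms are allowed because \<open>pb_a 1\<close> intertwines
  \<partial> with its square.\<close>

lemma pb_intertwine:
  assumes f: "f \<in> hom PB PB" and h: "h \<in> hom PB PB" and c: "c \<in> carrier PB"
    and sigma: "\<And>i. i \<ge> 1 \<Longrightarrow> c \<otimes>\<^bsub>PB\<^esub> f (pb_sigma i) = h (pb_sigma i) \<otimes>\<^bsub>PB\<^esub> c"
    and a: "\<And>i. i \<ge> 1 \<Longrightarrow> c \<otimes>\<^bsub>PB\<^esub> f (pb_a i) = h (pb_a i) \<otimes>\<^bsub>PB\<^esub> c"
    and x: "x \<in> carrier PB"
  shows "c \<otimes>\<^bsub>PB\<^esub> f x = h x \<otimes>\<^bsub>PB\<^esub> c"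
proof -
  interpret f: group_hom PB PB f
    by unfold_locales (rule f)
  interpret h: group_hom PB PB h
    by unfold_locales (rule h)
  have letter: "c \<otimes>\<^bsub>PB\<^esub> f (pb_class [(b, g)]) = h (pb_class [(b, g)]) \<otimes>\<^bsub>PB\<^esub> c"
    if g: "g \<in> pb_gens" for b g
  proof -
    have carr: "pb_class [(True, g)] \<in> carrier PB"
      using g by (simp add: pb_class_carrier words_over_simps)
    have pos: "c \<otimes>\<^bsub>PB\<^esub> f (pb_class [(True, g)]) = h (pb_class [(True, g)]) \<otimes>\<^bsub>PB\<^esub> c"
      using g sigma a by (auto elim!: pb_gensE simp: pb_sigma_def pb_a_def)
    show ?thesis
      using pos PB.intertwine_inv[OF _ _ c c pos[symmetric]] c carr g
      by (cases b) (simp_all add: pb_class_inv_letter)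
  qed
  obtain u where u: "u \<in> words_over pb_gens" and xu: "x = pb_class u"
    using x by (rule pb_carrierE)
  from u have "c \<otimes>\<^bsub>PB\<^esub> f (pb_class u) = h (pb_class u) \<otimes>\<^bsub>PB\<^esub> c"
  proof (induction u)
    case Nil
    then show ?case using c by (simp add: pb_class_Nil)
  next
    case (Cons l u)
    obtain b g where l: "l = (b, g)" by (cases l)
    have g: "g \<in> pb_gens" and u: "u \<in> words_over pb_gens"
      using Cons.prems by (simp_all add: l words_over_simps)
    let ?g = "pb_class [(b, g)]" and ?u = "pb_class u"
    have carr: "?g \<in> carrier PB" "?u \<in> carrier PB"
      using g u by (simp_all add: pb_class_carrier words_over_simps)
    have "c \<otimes>\<^bsub>PB\<^esub> f (?g \<otimes>\<^bsub>PB\<^esub> ?u) = (c \<otimes>\<^bsub>PB\<^esub> f ?g) \<otimes>\<^bsub>PB\<^esub> f ?u"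
      using c carr by (simp add: PB.m_assoc)
    also have "\<dots> = h ?g \<otimes>\<^bsub>PB\<^esub> (c \<otimes>\<^bsub>PB\<^esub> f ?u)"
      using c carr by (simp add: letter[OF g] PB.m_assoc)
    also have "\<dots> = h (?g \<otimes>\<^bsub>PB\<^esub> ?u) \<otimes>\<^bsub>PB\<^esub> c"
      using c carr by (simp add: Cons.IH[OF u] PB.m_assoc)
    finally show ?case
      by (simp add: l pb_class_Cons[OF g u])
  qed
  then show ?thesis by (simp add: xu)
qed

section \<open>Commutation of the first generators with shifted elements\<close>

lemma pb_shift_shift_hom: "(\<lambda>x. pb_shift (pb_shift x)) \<in> hom PB PB"
  by (rule homI) simp_all

text \<open>The double shift raises every index to at least 3, where the far commutation relations
  with \<open>pb_sigma 1\<close> apply.\<close>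

lemma pb_sigma_1_commute:
  assumes "x \<in> carrier PB"
  shows "pb_sigma 1 \<otimes>\<^bsub>PB\<^esub> pb_shift (pb_shift x) = pb_shift (pb_shift x) \<otimes>\<^bsub>PB\<^esub> pb_sigma 1"
  by (rule pb_intertwine[OF pb_shift_shift_hom pb_shift_shift_hom _ _ _ assms])
    (simp_all add: pb_sigma_in_carrier pb_shift_sigma pb_shift_a 
      pb_sigma_sigma[of 1, simplified] pb_sigma_a[of 1, simplified])

text \<open>On generators these are the relations that raise an index \<ge> 2 by one when the letter
  passes \<open>pb_a 1\<close>.\<close>

lemma pb_a_1_commute:
  assumes "x \<in> carrier PB"
  shows "pb_a 1 \<otimes>\<^bsub>PB\<^esub> pb_shift x = pb_shift (pb_shift x) \<otimes>\<^bsub>PB\<^esub> pb_a 1"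
  using pb_a_sigma[of 1] pb_a_a[of 1]
  by (intro pb_intertwine[OF pb_shift_hom pb_shift_shift_hom _ _ _ assms])
    (simp_all add: pb_a_in_carrier pb_shift_sigma pb_shift_a)

section \<open>Injectivity of the shift\<close>

primrec pb_delta :: "nat \<Rightarrow> pb" where
  "pb_delta 0 = \<one>\<^bsub>PB\<^esub>"
| "pb_delta (Suc n) = pb_delta n \<otimes>\<^bsub>PB\<^esub> pb_sigma (Suc n)"

lemma pb_delta_carrier [simp]: "pb_delta n \<in> carrier PB"
  by (induction n) (simp_all add: pb_sigma_in_carrier)

lemma pb_delta_commute:
  assumes c: "c \<in> carrier PB"
    and "\<And>i. 1 \<le> i \<Longrightarrow> i \<le> n \<Longrightarrow> c \<otimes>\<^bsub>PB\<^esub> pb_sigma i = pb_sigma i \<otimes>\<^bsub>PB\<^esub> c"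
  shows "c \<otimes>\<^bsub>PB\<^esub> pb_delta n = pb_delta n \<otimes>\<^bsub>PB\<^esub> c"
  using assms(2)
proof (induction n)
  case 0
  then show ?case using c by simp
next
  case (Suc n)
  have "c \<otimes>\<^bsub>PB\<^esub> pb_delta (Suc n) = (c \<otimes>\<^bsub>PB\<^esub> pb_delta n) \<otimes>\<^bsub>PB\<^esub> pb_sigma (Suc n)"
    using c by (simp add: PB.m_assoc pb_sigma_in_carrier)
  also have "c \<otimes>\<^bsub>PB\<^esub> pb_delta n = pb_delta n \<otimes>\<^bsub>PB\<^esub> c"
    using Suc by simp
  finally show ?case
    using c Suc.prems[of "Suc n"] by (simp add: PB.m_assoc pb_sigma_in_carrier)
qed

text \<open>For \<open>n = i + 1\<close>, the letter passes the factors of index below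
  \<open>i\<close> by commutation and then meets the braid relation. All later factors have index at
  least \<open>i + 2\<close> and commute with \<open>pb_sigma i\<close>.\<close>

lemma pb_sigma_delta:
  assumes i: "i \<ge> 1" and n: "n \<ge> i + 1"
  shows "pb_sigma (i + 1) \<otimes>\<^bsub>PB\<^esub> pb_delta n = pb_delta n \<otimes>\<^bsub>PB\<^esub> pb_sigma i"
  using n
proof (induction n rule: dec_induct)
  case base
  \<comment> \<open>With \<open>k = i - 1\<close>, \<open>pb_delta (i + 1)\<close> splits into
    \<open>pb_delta k\<close>, \<open>pb_sigma i\<close> and
    \<open>pb_sigma (i + 1)\<close>.\<close>
  obtain k where k: "i = Suc k" using i by (cases i) auto
  have s: "pb_sigma (Suc m) \<in> carrier PB" for m
    by (simp add: pb_sigma_in_carrier)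
  have comm: "pb_sigma (i + 1) \<otimes>\<^bsub>PB\<^esub> pb_delta k = pb_delta k \<otimes>\<^bsub>PB\<^esub> pb_sigma (i + 1)"
    by (rule pb_delta_commute) (simp_all add: k s pb_sigma_sigma[symmetric])
  have "pb_sigma (i + 1) \<otimes>\<^bsub>PB\<^esub> pb_delta (i + 1) =
      (pb_sigma (i + 1) \<otimes>\<^bsub>PB\<^esub> pb_delta k) \<otimes>\<^bsub>PB\<^esub> (pb_sigma i \<otimes>\<^bsub>PB\<^esub> pb_sigma (i + 1))"
    by (simp add: k s PB.m_assoc)
  also have "\<dots> = pb_delta k \<otimes>\<^bsub>PB\<^esub>
      (pb_sigma (i + 1) \<otimes>\<^bsub>PB\<^esub> (pb_sigma i \<otimes>\<^bsub>PB\<^esub> pb_sigma (i + 1)))"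
    unfolding comm by (simp add: k s PB.m_assoc)
  also have "\<dots> = pb_delta (i + 1) \<otimes>\<^bsub>PB\<^esub> pb_sigma i"
    unfolding pb_braid[OF i, symmetric] by (simp add: k s PB.m_assoc)
  finally show ?case .
next
  case (step n)
  have carr: "pb_sigma i \<in> carrier PB" "pb_sigma (i + 1) \<in> carrier PB"
      "pb_sigma (Suc n) \<in> carrier PB"
    using i by (simp_all add: pb_sigma_in_carrier)
  have "pb_sigma (i + 1) \<otimes>\<^bsub>PB\<^esub> pb_delta (Suc n) =
      (pb_sigma (i + 1) \<otimes>\<^bsub>PB\<^esub> pb_delta n) \<otimes>\<^bsub>PB\<^esub> pb_sigma (Suc n)"
    using carr by (simp add: PB.m_assoc)
  also have "\<dots> = pb_delta n \<otimes>\<^bsub>PB\<^esub> (pb_sigma i \<otimes>\<^bsub>PB\<^esub> pb_sigma (Suc n))"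
    unfolding step.IH using carr by (simp add: PB.m_assoc)
  also have "pb_sigma i \<otimes>\<^bsub>PB\<^esub> pb_sigma (Suc n) = pb_sigma (Suc n) \<otimes>\<^bsub>PB\<^esub> pb_sigma i"
    using pb_sigma_sigma[OF i] step.hyps by simp
  finally show ?case
    using carr by (simp add: PB.m_assoc)
qed

text \<open>For \<open>n = i\<close>, the last factor \<open>pb_sigma i\<close> is turned into two
  factors when the letter passes it, which lengthens the product by one. Each later factor has its
  index raised by one, which preserves this surplus.\<close>

lemma pb_a_delta:
  assumes i: "i \<ge> 1" and n: "n \<ge> i"
  shows "pb_a (i + 1) \<otimes>\<^bsub>PB\<^esub> pb_delta n = pb_delta (Suc n) \<otimes>\<^bsub>PB\<^esub> pb_a i"
  using n
proof (induction n rule: dec_induct)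
  case base
  obtain k where k: "i = Suc k" using i by (cases i) auto
  have s: "pb_sigma (Suc m) \<in> carrier PB" "pb_a (Suc m) \<in> carrier PB" for m
    by (simp_all add: pb_sigma_in_carrier pb_a_in_carrier)
  have comm: "pb_a (i + 1) \<otimes>\<^bsub>PB\<^esub> pb_delta k = pb_delta k \<otimes>\<^bsub>PB\<^esub> pb_a (i + 1)"
    by (rule pb_delta_commute) (simp_all add: k s pb_sigma_a[symmetric])
  have "pb_a (i + 1) \<otimes>\<^bsub>PB\<^esub> pb_delta i =
      (pb_a (i + 1) \<otimes>\<^bsub>PB\<^esub> pb_delta k) \<otimes>\<^bsub>PB\<^esub> pb_sigma i"
    by (simp add: k s PB.m_assoc)
  also have "\<dots> = pb_delta k \<otimes>\<^bsub>PB\<^esub> (pb_a (i + 1) \<otimes>\<^bsub>PB\<^esub> pb_sigma i)"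
    unfolding comm by (simp add: k s PB.m_assoc)
  also have "\<dots> = pb_delta (Suc i) \<otimes>\<^bsub>PB\<^esub> pb_a i"
    unfolding pb_sigma_sigma_a[OF i, symmetric] by (simp add: k s PB.m_assoc)
  finally show ?case .
next
  case (step n)
  have carr: "pb_a i \<in> carrier PB" "pb_a (i + 1) \<in> carrier PB"
      "pb_sigma (Suc n) \<in> carrier PB" "pb_sigma (Suc (Suc n)) \<in> carrier PB"
    using i by (simp_all add: pb_sigma_in_carrier pb_a_in_carrier)
  have "pb_a (i + 1) \<otimes>\<^bsub>PB\<^esub> pb_delta (Suc n) =
      (pb_a (i + 1) \<otimes>\<^bsub>PB\<^esub> pb_delta n) \<otimes>\<^bsub>PB\<^esub> pb_sigma (Suc n)"
    using carr by (simp add: PB.m_assoc)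
  also have "\<dots> = pb_delta (Suc n) \<otimes>\<^bsub>PB\<^esub> (pb_a i \<otimes>\<^bsub>PB\<^esub> pb_sigma (Suc n))"
    unfolding step.IH using carr by (simp add: PB.m_assoc)
  also have "pb_a i \<otimes>\<^bsub>PB\<^esub> pb_sigma (Suc n) = pb_sigma (Suc (Suc n)) \<otimes>\<^bsub>PB\<^esub> pb_a i"
    using pb_a_sigma[OF i, of "Suc n"] step.hyps by simp
  finally show ?case
    using carr by (simp add: PB.m_assoc)
qed

text \<open>The exponent sum is the difference of the counts for \<open>True\<close> and
  \<open>False\<close>. Keeping two natural numbers allows them to be added to the index of
  \<open>pb_delta\<close>.\<close>

definition a_count :: "bool \<Rightarrow> pb_gen word \<Rightarrow> nat" where
  "a_count b u = length (filter (\<lambda>(c, g). c = b \<and> g \<in> range A) u)"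

lemma a_count_simps [simp]:
  "a_count b [] = 0"
  "a_count b ((c, Sigma i) # u) = a_count b u"
  "a_count b ((c, A i) # u) = (if c = b then Suc (a_count b u) else a_count b u)"
  "a_count b (u @ v) = a_count b u + a_count b v"
  by (auto simp: a_count_def)

lemma a_count_shift [simp]: "a_count b (shift_word u) = a_count b u"
proof (induction u)
  case (Cons l u)
  obtain c g where "l = (c, g)" by (cases l)
  with Cons show ?case
    by (cases g) (simp_all add: shift_word_def)
qed (simp add: shift_word_def)

text \<open>Each defining relation has equally many letters \<open>A i\<close> on both sides, all
  positive, and a cancelling pair adds equally to both counts. Exponent sums are compared without
  subtraction.\<close>

lemma a_count_invariant:
  "pres_eq pb_gens pb_rels u v \<Longrightarrow>
    a_count True u + a_count False v = a_count True v + a_count False u"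
proof (induction rule: pres_eq.induct)
  case (cancel g b)
  then show ?case by (cases b; cases g) auto
next
  case (rel u v)
  from rel(1) show ?case by (induction rule: pb_rels.induct) simp_all
qed simp_all

lemma pb_letter_delta:
  assumes g: "g \<in> pb_gens"
  shows "\<exists>N. \<forall>n\<ge>N. pb_class (shift_word [(b, g)]) \<otimes>\<^bsub>PB\<^esub> pb_delta (n + a_count False [(b, g)])
    = pb_delta (n + a_count True [(b, g)]) \<otimes>\<^bsub>PB\<^esub> pb_class [(b, g)]"
proof -
  have g': "shift_gen g \<in> pb_gens"
    using g by (rule shift_gen_gens)
  have carr: "pb_class [(True, g)] \<in> carrier PB" "pb_class [(True, shift_gen g)] \<in> carrier PB"
    using g g' by (simp_all add: pb_class_carrier words_over_simps)
  obtain N where N: "\<And>n. n \<ge> N \<Longrightarrow>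
      pb_class [(True, shift_gen g)] \<otimes>\<^bsub>PB\<^esub> pb_delta n
      = pb_delta (n + a_count True [(True, g)]) \<otimes>\<^bsub>PB\<^esub> pb_class [(True, g)]"
    using g
  proof (cases rule: pb_gensE)
    case (1 i)
    then show ?thesis
      using that[of "i + 1"] pb_sigma_delta[of i] by (simp add: pb_sigma_def)
  next
    case (2 i)
    then show ?thesis
      using that[of i] pb_a_delta[of i] by (simp add: pb_a_def)
  qed
  \<comment> \<open>An inverse letter swaps the two counts, and inverting the relation for
    \<open>g\<close> swaps the indices of \<open>pb_delta\<close> in the same way, so one
    \<open>N\<close> serves both signs.\<close>
  have "a_count False [(True, g)] = 0" "a_count True [(False, g)] = 0"
    "a_count False [(False, g)] = a_count True [(True, g)]"
    by (simp_all add: a_count_def)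
  then show ?thesis
    using N PB.intertwine_inv[OF carr _ _ N] g g'
    by (cases b) (auto intro!: exI[of _ N] simp: shift_word_def pb_class_inv_letter)
qed

text \<open>Inverse letters \<open>A i\<close> raise the index on the left instead of lowering the
  one on the right, so all indices stay natural numbers. The relations compose along the word once
  \<open>n\<close> exceeds the bounds for head and tail.\<close>

lemma pb_word_delta:
  assumes "u \<in> words_over pb_gens"
  shows "\<exists>N. \<forall>n\<ge>N. pb_class (shift_word u) \<otimes>\<^bsub>PB\<^esub> pb_delta (n + a_count False u)
    = pb_delta (n + a_count True u) \<otimes>\<^bsub>PB\<^esub> pb_class u"
  using assms
proof (induction u)
  case Nil
  then show ?case by (simp add: shift_word_def pb_class_Nil)
next
  case (Cons l u)
  obtain b g where l: "l = (b, g)" by (cases l)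
  have g: "g \<in> pb_gens" and u: "u \<in> words_over pb_gens" and w: "[l] \<in> words_over pb_gens"
    using Cons.prems by (simp_all add: l words_over_simps)
  let ?p = "a_count True" and ?q = "a_count False"
  let ?l = "pb_class [l]" and ?l' = "pb_class (shift_word [l])"
  let ?u = "pb_class u" and ?u' = "pb_class (shift_word u)"
  have carr: "?l \<in> carrier PB" "?u \<in> carrier PB" "?l' \<in> carrier PB" "?u' \<in> carrier PB"
    using w u by (simp_all add: pb_class_carrier shift_word_words)
  obtain M N
    where M: "\<And>n. n \<ge> M \<Longrightarrow> ?l' \<otimes>\<^bsub>PB\<^esub> pb_delta (n + ?q [l]) = pb_delta (n + ?p [l]) \<otimes>\<^bsub>PB\<^esub> ?l"
      and N: "\<And>n. n \<ge> N \<Longrightarrow> ?u' \<otimes>\<^bsub>PB\<^esub> pb_delta (n + ?q u) = pb_delta (n + ?p u) \<otimes>\<^bsub>PB\<^esub> ?u"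
    using pb_letter_delta[OF g, of b] Cons.IH[OF u] unfolding l by blast
  have split: "l # u = [l] @ u" by simp
  have "pb_class (shift_word (l # u)) \<otimes>\<^bsub>PB\<^esub> pb_delta (n + ?q (l # u))
      = pb_delta (n + ?p (l # u)) \<otimes>\<^bsub>PB\<^esub> pb_class (l # u)" if n: "n \<ge> max M N" for n
  proof -
    have "pb_class (shift_word (l # u)) \<otimes>\<^bsub>PB\<^esub> pb_delta (n + ?q (l # u))
        = ?l' \<otimes>\<^bsub>PB\<^esub> (?u' \<otimes>\<^bsub>PB\<^esub> pb_delta ((n + ?q [l]) + ?q u))"
      unfolding split a_count_simps(4) shift_word_append
      using carr w u by (simp add: pb_class_append shift_word_words PB.m_assoc add.assoc)
    \<comment> \<open>The tail is used at \<open>n + ?q [l]\<close>, and next the head at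
      \<open>n + ?p u\<close>; both stay above their bounds since counts are only added.\<close>
    also have "\<dots> = ?l' \<otimes>\<^bsub>PB\<^esub> pb_delta ((n + ?p u) + ?q [l]) \<otimes>\<^bsub>PB\<^esub> ?u"
      using N[of "n + ?q [l]"] n carr by (simp add: PB.m_assoc ac_simps)
    also have "\<dots> = pb_delta (n + ?p u + ?p [l]) \<otimes>\<^bsub>PB\<^esub> ?l \<otimes>\<^bsub>PB\<^esub> ?u"
      using M[of "n + ?p u"] n by simp
    also have "\<dots> = pb_delta (n + ?p (l # u)) \<otimes>\<^bsub>PB\<^esub> pb_class (l # u)"
      using carr pb_class_append[OF w u] a_count_simps(4)[of True "[l]" u]
      by (simp add: PB.m_assoc ac_simps)
    finally show ?thesis .
  qed
  then show ?case by blast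
qed

lemma pb_shift_inj: "inj_on pb_shift (carrier PB)"
proof (rule inj_onI)
  fix x y assume x: "x \<in> carrier PB" and y: "y \<in> carrier PB" and eq: "pb_shift x = pb_shift y"
  obtain u v where u: "u \<in> words_over pb_gens" "x = pb_class u"
    and v: "v \<in> words_over pb_gens" "y = pb_class v"
    using x y by (metis pb_carrierE)
  let ?p = "a_count True" and ?q = "a_count False"
  have eq': "pb_class (shift_word u) = pb_class (shift_word v)"
    using eq u v by (simp add: pb_shift_class)
  \<comment> \<open>Shifting leaves the counts of a word unchanged, so equivalence of the shifted
    words equates the exponent sums of \<open>u\<close> and \<open>v\<close>.\<close>
  then have "pres_eq pb_gens pb_rels (shift_word u) (shift_word v)"
    using u v by (simp add: pres_class_eq_iff shift_word_words)
  from a_count_invariant[OF this] have count: "?p u + ?q v = ?p v + ?q u"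
    by simp
  obtain M N
    where M: "\<And>n. n \<ge> M \<Longrightarrow>
        pb_class (shift_word u) \<otimes>\<^bsub>PB\<^esub> pb_delta (n + ?q u) = pb_delta (n + ?p u) \<otimes>\<^bsub>PB\<^esub> x"
      and N: "\<And>n. n \<ge> N \<Longrightarrow>
        pb_class (shift_word v) \<otimes>\<^bsub>PB\<^esub> pb_delta (n + ?q v) = pb_delta (n + ?p v) \<otimes>\<^bsub>PB\<^esub> y"
    using pb_word_delta[OF u(1)] pb_word_delta[OF v(1)] unfolding u(2) v(2) by blast
  define n where "n = max M N"
  \<comment> \<open>Evaluation at \<open>n + ?q v\<close> for \<open>u\<close> and at
    \<open>n + ?q u\<close> for \<open>v\<close> gives the shifted words the same right factor. By
    \<open>count\<close> the indices in front of \<open>x\<close> and \<open>y\<close> agree too,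
    and that factor cancels.\<close>
  have "pb_delta (n + ?q v + ?p u) \<otimes>\<^bsub>PB\<^esub> x
      = pb_class (shift_word u) \<otimes>\<^bsub>PB\<^esub> pb_delta (n + ?q v + ?q u)"
    using M[of "n + ?q v"] by (simp add: n_def)
  also have "\<dots> = pb_class (shift_word v) \<otimes>\<^bsub>PB\<^esub> pb_delta (n + ?q u + ?q v)"
    by (simp add: eq' ac_simps)
  also have "\<dots> = pb_delta (n + ?q u + ?p v) \<otimes>\<^bsub>PB\<^esub> y"
    using N[of "n + ?q u"] by (simp add: n_def)
  also have "n + ?q u + ?p v = n + ?q v + ?p u"
    using count by simp
  finally show "x = y"
    using x y by simp
qed

section \<open>The augmented LD-system and left cancellation\<close>

theorem proposition3p5:
  "augmented_LD_system (carrier PB) pb_bracket pb_circ \<and>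
   (\<forall>x\<in>carrier PB. \<forall>y\<in>carrier PB. \<forall>z\<in>carrier PB.
      pb_bracket x y = pb_bracket x z \<longrightarrow> y = z)"
proof (intro conjI ballI impI)
  have carr: "pb_sigma 1 \<in> carrier PB" "pb_sigma 2 \<in> carrier PB"
      "pb_a 1 \<in> carrier PB" "pb_a 2 \<in> carrier PB"
    by (simp_all add: pb_sigma_in_carrier pb_a_in_carrier)
  have shift: "pb_shift (pb_sigma 1) = pb_sigma 2" "pb_shift (pb_a 1) = pb_a 2"
    using pb_shift_sigma[of 1] pb_shift_a[of 1] by (simp_all add: numeral_2_eq_2)
  have rels:
    "pb_sigma 1 \<otimes>\<^bsub>PB\<^esub> pb_shift (pb_sigma 1) \<otimes>\<^bsub>PB\<^esub> pb_sigma 1 =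
      pb_shift (pb_sigma 1) \<otimes>\<^bsub>PB\<^esub> pb_sigma 1 \<otimes>\<^bsub>PB\<^esub> pb_shift (pb_sigma 1)"
    "pb_shift (pb_sigma 1) \<otimes>\<^bsub>PB\<^esub> pb_sigma 1 \<otimes>\<^bsub>PB\<^esub> pb_shift (pb_a 1) = pb_a 1 \<otimes>\<^bsub>PB\<^esub> pb_sigma 1"
    "pb_sigma 1 \<otimes>\<^bsub>PB\<^esub> pb_shift (pb_sigma 1) \<otimes>\<^bsub>PB\<^esub> pb_a 1 = pb_shift (pb_a 1) \<otimes>\<^bsub>PB\<^esub> pb_sigma 1"
    using pb_braid[of 1] pb_sigma_sigma_a_Suc[of 1] pb_sigma_sigma_a[of 1] carr
    by (simp_all only: shift one_add_one order.refl PB.m_assoc)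
  note laws = PB.shifted_bracket_laws[OF pb_shift_hom carr(1,3) pb_sigma_1_commute
      pb_a_1_commute rels, folded pb_bracket_def pb_circ_def]
  have closed: "pb_bracket x y \<in> carrier PB" "pb_circ x y \<in> carrier PB"
    if "x \<in> carrier PB" "y \<in> carrier PB" for x y
    using that carr by (simp_all add: pb_bracket_def pb_circ_def)
  show "augmented_LD_system (carrier PB) pb_bracket pb_circ"
    unfolding augmented_LD_system_def by (intro conjI ballI closed laws)
  fix x y z
  assume xyz: "x \<in> carrier PB" "y \<in> carrier PB" "z \<in> carrier PB"
    and "pb_bracket x y = pb_bracket x z"
  \<comment> \<open>All factors of the bracket other than the shift of its second argument depend
    only on \<open>x\<close> and cancel.\<close>
  then have "pb_shift y = pb_shift z"
    using carr by (simp add: pb_bracket_def)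
  then show "y = z"
    using pb_shift_inj xyz by (simp add: inj_on_eq_iff)
qed

end
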